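(* Let $\mathbf{g} = s_r + s_d\mathbf{I} + \mathbf{\Xi}$ be a rotor in the even subalgebra of the Clifford algebra of signature $(3,0,1)$, with $s_r,s_d\in\mathbb{R}$, $\mathbf{\Xi}$ a bivector, $\mathbf{g}\widetilde{\mathbf{g}}=1$, and suppose $s_d\neq 0$. Let $(t+u\mathbf{I})\mathbf{\Phi}$ be the logarithm of $\mathbf{g}$. Then $u\neq 0$, $t\neq 0$, and $\mathbf{g}$ represents (via $\mathbf{X}\mapsto\mathbf{g}\mathbf{X}\widetilde{\mathbf{g}}$) a screw motion along the axis $\mathbf{\Phi}$ consisting of a rotation by angle $2t$ and a translation by distance $2u$.
   Context: Algebra: the real Clifford algebra with generators $\mathbf{e}_0,\mathbf{e}_1,\mathbf{e}_2,\mathbf{e}_3$, which anticommute pairwise, $\mathbf{e}_0^2=0$, $\mathbf{e}_1^2=\mathbf{e}_2^2=\mathbf{e}_3^2=1$. Write $\mathbf{e}_{ij}=\mathbf{e}_i\mathbf{e}_j$ ($i\ne j$), $\mathbf{I}=\mathbf{e}_0\mathbf{e}_1\mathbf{e}_2\mathbf{e}_3$ (so $\mathbf{I}^2=0$), and $\widetilde{\ }$ for reversal. A 1-vector $a_0\mathbf{e}_0+a_1\mathbf{e}_1+a_2\mathbf{e}_2+a_3\mathbf{e}_3$ represents the plane $a_0+a_1x+a_2y+a_3z=0$; the euclidean point $(x,y,z)$ is represented by $\mathbf{E}_0+x\mathbf{E}_1+y\mathbf{E}_2+z\mathbf{E}_3$ where $\mathbf{E}_0=\mathbf{e}_1\mathbf{e}_2\mathbf{e}_3$,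 $\mathbf{E}_1=\mathbf{e}_0\mathbf{e}_3\mathbf{e}_2$, $\mathbf{E}_2=\mathbf{e}_0\mathbf{e}_1\mathbf{e}_3$, $\mathbf{E}_3=\mathbf{e}_0\mathbf{e}_2\mathbf{e}_1$. A bivector is a linear combination of $\mathbf{e}_{01},\mathbf{e}_{02},\mathbf{e}_{03},\mathbf{e}_{12},\mathbf{e}_{31},\mathbf{e}_{23}$; it is simple if it is the outer product $\mathbf{a}\wedge\mathbf{b}$ of two 1-vectors, in which case it represents the intersection line of the two planes. A bivector is euclidean if its $\mathbf{e}_{12},\mathbf{e}_{31},\mathbf{e}_{23}$ part is nonzero. Rotor: an element $\mathbf{g}$ of the even subalgebra with $\mathbf{g}\widetilde{\mathbf{g}}=1$; it represents the euclidean isometry acting by $\mathbf{X}\mapsto\mathbf{g}\mathbf{X}\widetilde{\mathbf{g}}$ on points, lines and planes. Axis of a euclidean bivector $\mathbf{\Xi}$: the simple euclidean bivector $\mathbf{\Phi}$ of the form $\mathbf{\Phi}=(a+b\mathbf{I})\mathbf{\Xi}$ with $a,b\in\mathbb{R}$, $a\neq0$, normalized so that $\mathbf{\Phi}^2=-1$ (determined up to sign). (When $s_d\neq0$, the bivector part $\mathbf{\Xi}$ of the rotor is euclidean.) Logarithm of a rotor $\mathbf{g}=s_r+s_d\mathbf{I}+\mathbf{\Xi}$ with $s_d\ne0$: let $\mathbf{\Phi}=(a+b\mathbf{I})\mathbf{\Xi}$ be the axis of $\mathbf{\Xi}$, put $c+d\mathbf{I}:=(a+b\mathbf{I})^{-1}$,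 so that $\mathbf{\Xi}=(c+d\mathbf{I})\mathbf{\Phi}$. Let $t:=\tan^{-1}(c,s_r)$ be the two-argument arctangent, i.e. the polar angle $t\in(-\pi,\pi]$ of the point with abscissa $s_r$ and ordinate $c$; and let $u:=d/\cos t$ if $|\cos t|>|\sin t|$, and $u:=-s_d/\sin t$ otherwise. The logarithm of $\mathbf{g}$ is the bivector $(t+u\mathbf{I})\mathbf{\Phi}$. Screw motion: an isometry that can be factored as a rotation around a line (its axis) followed by a translation in the direction of that line. The signs of the angle $2t$ and the distance $2u$ encode the sense of the rotation and of the translation. *)

theory Defs
  imports "HOL-Analysis.Analysis"
begin

text \<open>
  A multivector of the real Clifford algebra of signature (3,0,1) is given by its 16 coefficients with respect to the basis blades
  \<open>e\<^sub>A = e\<^sub>i\<^sub>1 \<cdots> e\<^sub>i\<^sub>k\<close>, where \<open>A = {i1 < \<dots> < ik}\<close> is a set of indices from the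
  four-element numeral type \<open>4\<close>, whose elements are ordered \<open>0 < 1 < 2 < 3\<close>.
\<close>

typedef pga = "UNIV :: (4 set \<Rightarrow> real) set"
  morphisms coeff Abs_pga by simp

setup_lifting type_definition_pga

lemma pga_eq_iff: "x = y \<longleftrightarrow> (\<forall>A. coeff x A = coeff y A)"
  by transfer (simp add: fun_eq_iff)

text \<open>
  Sorting the word \<open>e\<^sub>A e\<^sub>B\<close>: each pair \<open>(i, j) \<in> A \<times> B\<close> with \<open>j < i\<close> costs a transposition,
  and each coincidence \<open>i = j\<close> contributes \<open>q i\<close>, the square of the generator. The result is
  \<open>reorder q A B\<close> times the blade of the symmetric difference.
\<close>

definition reorder :: "(4 \<Rightarrow> real) \<Rightarrow> 4 set \<Rightarrow> 4 set \<Rightarrow> real" where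
  "reorder q A B = (\<Prod>i\<in>A. \<Prod>j\<in>B. if j < i then -1 else if i = j then q i else 1)"

definition gen_square :: "4 \<Rightarrow> real" where
  "gen_square i = (if i = 0 then 0 else 1)"

definition blade_prod ::
  "(4 \<Rightarrow> real) \<Rightarrow> (4 set \<Rightarrow> real) \<Rightarrow> (4 set \<Rightarrow> real) \<Rightarrow> 4 set \<Rightarrow> real" where
  "blade_prod q x y C =
     (\<Sum>A\<in>UNIV. \<Sum>B\<in>UNIV. if sym_diff A B = C then reorder q A B * x A * y B else 0)"

lemma sym_diff_cancel: "sym_diff A (sym_diff A B) = B"
  by auto

lemma blade_prod_alt:
  "blade_prod q x y C = (\<Sum>A\<in>UNIV. reorder q A (sym_diff A C) * x A * y (sym_diff A C))"
proof -
  have eq: "(sym_diff A B = C) = (B = sym_diff A C)" for A B :: "4 set"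
    by auto
  show ?thesis
    unfolding blade_prod_def eq by simp
qed

lemma reorder_UNIV:
  "reorder q A B = (\<Prod>i\<in>UNIV. \<Prod>j\<in>UNIV. if i \<in> A \<and> j \<in> B
     then (if j < i then -1 else if i = j then q i else 1) else 1)"
proof -
  have *: "prod f A = (\<Prod>i\<in>UNIV. if i \<in> A then f i else 1)" for f :: "4 \<Rightarrow> real" and A
    by (simp add: prod.If_cases)
  show ?thesis
    unfolding reorder_def by (subst (1 2) *) (auto intro!: prod.cong)
qed

lemma reorder_cocycle:
  "reorder q A B * reorder q (sym_diff A B) D = reorder q A (sym_diff B D) * reorder q B D"
proof -
  define s where "s A B i j = (if i \<in> A \<and> j \<in> B
    then (if j < i then -1 else if i = j then q i else 1) else 1)" for A B :: "4 set" and i j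
  have s: "reorder q A B = (\<Prod>i\<in>UNIV. \<Prod>j\<in>UNIV. s A B i j)" for A B
    unfolding reorder_UNIV s_def ..
  have "s A B i j * s (sym_diff A B) D i j = s A (sym_diff B D) i j * s B D i j" for i j
    by (cases "i \<in> A"; cases "i \<in> B"; cases "j \<in> B"; cases "j \<in> D"; cases "i = j"; cases "j < i")
       (simp_all add: s_def)
  then show ?thesis
    by (simp only: s prod.distrib[symmetric])
qed

lemma blade_prod_assoc:
  "blade_prod q (blade_prod q x y) z = blade_prod q x (blade_prod q y z)"
proof
  fix C
  have bij: "bij_betw (\<lambda>E. sym_diff A E) UNIV UNIV" for A :: "4 set"
    by (rule bij_betwI[where g="\<lambda>E. sym_diff A E"]) (auto)
  have "blade_prod q (blade_prod q x y) z C
     = (\<Sum>E\<in>UNIV. \<Sum>A\<in>UNIV. reorder q A (sym_diff A E) * reorder q E (sym_diff E C)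
          * x A * y (sym_diff A E) * z (sym_diff E C))"
    unfolding blade_prod_alt by (simp only: sum_distrib_left sum_distrib_right mult_ac)
  also have "\<dots> = (\<Sum>A\<in>UNIV. \<Sum>E\<in>UNIV. reorder q A (sym_diff A E) * reorder q E (sym_diff E C)
          * x A * y (sym_diff A E) * z (sym_diff E C))"
    by (rule sum.swap)
  also have "\<dots> = (\<Sum>A\<in>UNIV. \<Sum>B\<in>UNIV. reorder q A B
          * reorder q (sym_diff A B) (sym_diff (sym_diff A B) C)
          * x A * y B * z (sym_diff (sym_diff A B) C))"
  proof (rule sum.cong[OF refl])
    fix A :: "4 set"
    show "(\<Sum>E\<in>UNIV. reorder q A (sym_diff A E) * reorder q E (sym_diff E C)
          * x A * y (sym_diff A E) * z (sym_diff E C))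
        = (\<Sum>B\<in>UNIV. reorder q A B * reorder q (sym_diff A B) (sym_diff (sym_diff A B) C)
          * x A * y B * z (sym_diff (sym_diff A B) C))"
      by (subst sum.reindex_bij_betw[OF bij[of A], symmetric]) (simp only: sym_diff_cancel)
  qed
  also have "\<dots> = (\<Sum>A\<in>UNIV. \<Sum>B\<in>UNIV. reorder q A (sym_diff A C)
          * reorder q B (sym_diff B (sym_diff A C))
          * x A * y B * z (sym_diff B (sym_diff A C)))"
  proof (intro sum.cong refl)
    fix A B :: "4 set"
    have 1: "sym_diff (sym_diff A B) C = sym_diff B (sym_diff A C)"
      by auto
    have 2: "sym_diff B (sym_diff B (sym_diff A C)) = sym_diff A C"
      by (rule sym_diff_cancel)
    show "reorder q A B * reorder q (sym_diff A B) (sym_diff (sym_diff A B) C)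
          * x A * y B * z (sym_diff (sym_diff A B) C)
        = reorder q A (sym_diff A C) * reorder q B (sym_diff B (sym_diff A C))
          * x A * y B * z (sym_diff B (sym_diff A C))"
      using reorder_cocycle[of q A B "sym_diff B (sym_diff A C)"] by (simp only: 1 2)
  qed
  also have "\<dots> = blade_prod q x (blade_prod q y z) C"
    unfolding blade_prod_alt by (simp only: sum_distrib_left sum_distrib_right mult_ac)
  finally show "blade_prod q (blade_prod q x y) z C = blade_prod q x (blade_prod q y z) C" .
qed

lemma reorder_empty [simp]: "reorder q {} B = 1" "reorder q A {} = 1"
  by (simp_all add: reorder_def)

instantiation pga :: real_algebra_1
begin

lift_definition zero_pga :: pga is "\<lambda>A. 0" .
lift_definition one_pga :: pga is "\<lambda>A. if A = {} then 1 else 0" .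
lift_definition plus_pga :: "pga \<Rightarrow> pga \<Rightarrow> pga" is "\<lambda>x y A. x A + y A" .
lift_definition minus_pga :: "pga \<Rightarrow> pga \<Rightarrow> pga" is "\<lambda>x y A. x A - y A" .
lift_definition uminus_pga :: "pga \<Rightarrow> pga" is "\<lambda>x A. - x A" .
lift_definition scaleR_pga :: "real \<Rightarrow> pga \<Rightarrow> pga" is "\<lambda>r x A. r * x A" .
lift_definition times_pga :: "pga \<Rightarrow> pga \<Rightarrow> pga" is "blade_prod gen_square" .

instance
proof
  fix x y z :: pga and r s :: real
  show "x * y * z = x * (y * z)"
    by transfer (rule blade_prod_assoc)
  show "(x + y) * z = x * z + y * z" "x * (y + z) = x * y + x * z"
    by (simp_all add: pga_eq_iff times_pga.rep_eq plus_pga.rep_eq blade_prod_alt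
        distrib_left distrib_right sum.distrib)
  show "r *\<^sub>R x * y = r *\<^sub>R (x * y)" "x * r *\<^sub>R y = r *\<^sub>R (x * y)"
    by (simp_all add: pga_eq_iff times_pga.rep_eq scaleR_pga.rep_eq blade_prod_alt
        sum_distrib_left mult_ac)
  show "1 * x = x"
    by transfer (simp add: fun_eq_iff blade_prod_alt if_distrib[of "\<lambda>v. _ * v"]
        if_distrib[of "\<lambda>v. v * _"] cong: if_cong)
  show "x * 1 = x"
  proof transfer
    fix x :: "4 set \<Rightarrow> real"
    have eq: "(sym_diff A C = {}) = (C = A)" for A C :: "4 set"
      by auto
    show "blade_prod gen_square x (\<lambda>A. if A = {} then 1 else 0) = x"
      unfolding blade_prod_alt eq fun_eq_iff
      by (simp add: if_distrib[of "\<lambda>v. _ * v"] cong: if_cong)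
  qed
  show "(0::pga) \<noteq> 1"
    by transfer (auto simp: fun_eq_iff)
  show "x + y + z = x + (y + z)" "x + y = y + x" "0 + x = x" "- x + x = 0" "x - y = x + - y"
    by (simp_all add: pga_eq_iff zero_pga.rep_eq plus_pga.rep_eq minus_pga.rep_eq
        uminus_pga.rep_eq)
  show "r *\<^sub>R (x + y) = r *\<^sub>R x + r *\<^sub>R y" "(r + s) *\<^sub>R x = r *\<^sub>R x + s *\<^sub>R x"
       "r *\<^sub>R s *\<^sub>R x = (r * s) *\<^sub>R x" "1 *\<^sub>R x = x"
    by (simp_all add: pga_eq_iff plus_pga.rep_eq scaleR_pga.rep_eq ring_distribs)
qed

end

lift_definition blade :: "4 set \<Rightarrow> pga" is "\<lambda>A B. if B = A then 1 else 0" .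

abbreviation e :: "4 \<Rightarrow> pga" where
  "e i \<equiv> blade {i}"

lemma sorted_indices [simp]:
  "(0::4) < 1" "(0::4) < 2" "(0::4) < 3" "(1::4) < 2" "(1::4) < 3" "(2::4) < 3"
  by (simp_all add: less_bit0_def bit0.Rep_0 bit0.Rep_1 bit0.Rep_numeral)

lemma blade_mult: "blade A * blade B = reorder gen_square A B *\<^sub>R blade (sym_diff A B)"
proof -
  have "(\<Sum>A'\<in>UNIV. reorder gen_square A' (sym_diff A' C) * (if A' = A then 1 else 0)
           * (if sym_diff A' C = B then 1 else 0))
      = (\<Sum>A'\<in>UNIV. if A' = A then reorder gen_square A (sym_diff A C)
           * (if sym_diff A C = B then 1 else 0) else 0)" for C
    by (rule sum.cong) auto
  moreover have "sym_diff A C = B \<longleftrightarrow> C = sym_diff A B" for C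
    by auto
  ultimately show ?thesis
    by (auto simp: pga_eq_iff times_pga.rep_eq scaleR_pga.rep_eq blade.rep_eq blade_prod_alt
        sym_diff_cancel)
qed

lemma blade_empty: "blade {} = 1"
  by (simp add: pga_eq_iff blade.rep_eq one_pga.rep_eq)

lemma e_square: "e i * e i = of_real (gen_square i)"
  by (simp add: blade_mult reorder_def blade_empty of_real_def)

lemma e_anticommute: "i \<noteq> j \<Longrightarrow> e i * e j = - (e j * e i)"
  by (auto simp: blade_mult reorder_def insert_commute Un_commute)

definition pseudoscalar :: pga where
  "pseudoscalar = e 0 * e 1 * e 2 * e 3"

lift_definition outer :: "pga \<Rightarrow> pga \<Rightarrow> pga" is "blade_prod (\<lambda>i. 0)" .

text \<open>Reversing a word of \<open>k\<close> anticommuting generators takes \<open>k choose 2\<close> transpositions.\<close>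

lift_definition reversal :: "pga \<Rightarrow> pga" is "\<lambda>x A. (-1) ^ (card A choose 2) * x A" .

definition has_grade :: "nat \<Rightarrow> pga \<Rightarrow> bool" where
  "has_grade k x \<longleftrightarrow> (\<forall>A. card A \<noteq> k \<longrightarrow> coeff x A = 0)"

abbreviation vector1 :: "pga \<Rightarrow> bool" where
  "vector1 \<equiv> has_grade 1"

abbreviation bivector :: "pga \<Rightarrow> bool" where
  "bivector \<equiv> has_grade 2"

definition even_multivector :: "pga \<Rightarrow> bool" where
  "even_multivector x \<longleftrightarrow> (\<forall>A. odd (card A) \<longrightarrow> coeff x A = 0)"

definition rotor :: "pga \<Rightarrow> bool" where
  "rotor g \<longleftrightarrow> even_multivector g \<and> g * reversal g = 1"

definition simple_bivector :: "pga \<Rightarrow> bool" where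
  "simple_bivector \<Phi> \<longleftrightarrow> (\<exists>a b. vector1 a \<and> vector1 b \<and> \<Phi> = outer a b)"

definition euclidean_bivector :: "pga \<Rightarrow> bool" where
  "euclidean_bivector \<Phi> \<longleftrightarrow> bivector \<Phi> \<and>
     (coeff \<Phi> {1, 2} \<noteq> 0 \<or> coeff \<Phi> {1, 3} \<noteq> 0 \<or> coeff \<Phi> {2, 3} \<noteq> 0)"


definition point :: "real^3 \<Rightarrow> pga" where
  "point p = e 1 * e 2 * e 3 + (p$1) *\<^sub>R (e 0 * e 3 * e 2)
     + (p$2) *\<^sub>R (e 0 * e 1 * e 3) + (p$3) *\<^sub>R (e 0 * e 2 * e 1)"

definition plane_points :: "pga \<Rightarrow> (real^3) set" where
  "plane_points a = {p. coeff a {0} + coeff a {1} * p$1 + coeff a {2} * p$2 + coeff a {3} * p$3 = 0}"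

text \<open>For a nonzero simple bivector the set below does not depend on the factorization.\<close>

definition line_points :: "pga \<Rightarrow> (real^3) set" where
  "line_points \<Phi> = {p. \<exists>a b. vector1 a \<and> vector1 b \<and> \<Phi> = outer a b
     \<and> p \<in> plane_points a \<and> p \<in> plane_points b}"

definition represents_motion :: "pga \<Rightarrow> (real^3 \<Rightarrow> real^3) \<Rightarrow> bool" where
  "represents_motion g f \<longleftrightarrow>
     (\<forall>p. g * point p * reversal g = point (f p)) \<and>
     (\<forall>a. vector1 a \<longrightarrow> vector1 (g * a * reversal g) \<and>
        plane_points (g * a * reversal g) = f ` plane_points a) \<and>
     (\<forall>\<Lambda>. simple_bivector \<Lambda> \<longrightarrow> simple_bivector (g * \<Lambda> * reversal g) \<and>
        line_points (g * \<Lambda> * reversal g) = f ` line_points \<Lambda>)"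


text \<open>Rodrigues' formula: the right-handed rotation by \<open>\<theta>\<close> about the line through \<open>p\<close>
  with unit direction \<open>v\<close>.\<close>

definition rotation_about :: "real^3 \<Rightarrow> real^3 \<Rightarrow> real \<Rightarrow> real^3 \<Rightarrow> real^3" where
  "rotation_about p v \<theta> x = p + cos \<theta> *\<^sub>R (x - p) + sin \<theta> *\<^sub>R cross3 v (x - p)
     + ((1 - cos \<theta>) * (v \<bullet> (x - p))) *\<^sub>R v"

text \<open>
  The unit direction of the oriented line \<open>\<Phi> = a \<and> b\<close>: the coordinates with respect to
  \<open>e\<^sub>2\<^sub>3, e\<^sub>3\<^sub>1, e\<^sub>1\<^sub>2\<close> (note \<open>e\<^sub>3\<^sub>1 = - e\<^sub>1\<^sub>3\<close>) are those of \<open>n\<^sub>a \<times> n\<^sub>b\<close>, the cross product of the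
  normals of the two planes.
\<close>

definition line_direction :: "pga \<Rightarrow> real^3" where
  "line_direction \<Phi> = sgn (vector [coeff \<Phi> {2, 3}, - coeff \<Phi> {1, 3}, coeff \<Phi> {1, 2}])"

text \<open>
  Sign conventions: a positive distance is a translation along \<open>line_direction \<Phi>\<close>; a positive
  angle turns the second plane \<open>b\<close> towards the first plane \<open>a\<close> of \<open>\<Phi> = a \<and> b\<close>, so for
  \<open>\<Phi> = e\<^sub>1\<^sub>2\<close> it turns the \<open>y\<close>-axis towards the \<open>x\<close>-axis. This is the sense in which
  \<open>cos t + sin t \<Phi>\<close> with small \<open>t > 0\<close> acts by \<open>X \<mapsto> g X g~\<close>; it is right-handed
  about \<open>- line_direction \<Phi>\<close>. Replacing \<open>\<Phi>\<close> by \<open>- \<Phi>\<close> reverses both senses.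
\<close>

definition screw_motion :: "pga \<Rightarrow> real \<Rightarrow> real \<Rightarrow> (real^3 \<Rightarrow> real^3) \<Rightarrow> bool" where
  "screw_motion \<Phi> \<theta> \<delta> f \<longleftrightarrow> (\<exists>p \<in> line_points \<Phi>.
     f = (\<lambda>x. x + \<delta> *\<^sub>R line_direction \<Phi>) \<circ> rotation_about p (- line_direction \<Phi>) \<theta>)"


definition is_axis :: "pga \<Rightarrow> real \<Rightarrow> real \<Rightarrow> pga \<Rightarrow> bool" where
  "is_axis \<Xi> a b \<Phi> \<longleftrightarrow> a \<noteq> 0 \<and> \<Phi> = (of_real a + of_real b * pseudoscalar) * \<Xi>
     \<and> simple_bivector \<Phi> \<and> euclidean_bivector \<Phi> \<and> \<Phi> * \<Phi> = -1"

text \<open>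
  \<open>is_log s_r s_d \<Xi> t u \<Phi>\<close>: the rotor \<open>s_r + s_d I + \<Xi>\<close> with \<open>s_d \<noteq> 0\<close> has logarithm
  \<open>(t + u I) \<Phi>\<close>. This is a relation because \<open>\<Phi>\<close> is determined only up to sign.
\<close>

definition is_log :: "real \<Rightarrow> real \<Rightarrow> pga \<Rightarrow> real \<Rightarrow> real \<Rightarrow> pga \<Rightarrow> bool" where
  "is_log s_r s_d \<Xi> t u \<Phi> \<longleftrightarrow> (\<exists>a b c d. is_axis \<Xi> a b \<Phi>
     \<and> (of_real a + of_real b * pseudoscalar) * (of_real c + of_real d * pseudoscalar) = 1
     \<and> t = Arg (Complex s_r c)
     \<and> u = (if \<bar>cos t\<bar> > \<bar>sin t\<bar> then d / cos t else - s_d / sin t))"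

end

theory Submission
  imports Defs
begin

unbundle cross3_syntax

text \<open>
  Write \<open>\<epsilon> = e\<^sub>1 e\<^sub>2 e\<^sub>3\<close> and identify a vector \<open>x\<close> of \<open>\<real>\<^sup>3\<close> with \<open>x\<^sub>1 e\<^sub>1 + x\<^sub>2 e\<^sub>2 + x\<^sub>3 e\<^sub>3\<close>. The
  product of two such vectors is \<open>x \<bullet> y + \<epsilon> (x \<times> y)\<close>, and \<open>\<epsilon>\<close> commutes with vectors, squares to
  \<open>-1\<close> and satisfies \<open>I = e\<^sub>0 \<epsilon>\<close>. In this language the point \<open>p\<close> is \<open>\<epsilon> - e\<^sub>0 \<epsilon> p\<close>, and the oriented
  line through \<open>p\<close> with unit direction \<open>v\<close> is \<open>\<epsilon> v + e\<^sub>0 (p \<times> v)\<close>. Every computation below becomes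
  vector algebra in \<open>\<real>\<^sup>3\<close>.

  Since \<open>\<Phi>\<^sup>2 = -1\<close> and \<open>I\<close> is central in the even subalgebra, the equation \<open>g g~ = 1\<close> reads
  \<open>(s\<^sub>r + s\<^sub>d I)\<^sup>2 + (c + d I)\<^sup>2 = 1\<close>, that is, \<open>s\<^sub>r\<^sup>2 + c\<^sup>2 = 1\<close> and \<open>s\<^sub>r s\<^sub>d + c d = 0\<close>. Hence
  \<open>s\<^sub>r = cos t\<close> and \<open>c = sin t\<close>, and the second equation says that \<open>(d, s\<^sub>d)\<close> is a multiple of
  \<open>(cos t, - sin t)\<close>; the two branches in the definition of \<open>u\<close> are two ways to compute the
  factor without dividing by zero. With \<open>s\<^sub>d = - u sin t \<noteq> 0\<close> neither \<open>u\<close> nor \<open>t\<close> can vanish.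
  Moreover
  \<open>g = cos t - u sin t I + (sin t + u cos t I) \<Phi> = (1 + u I \<Phi>) (cos t + sin t \<Phi>)\<close>,
  where \<open>I \<Phi> = - e\<^sub>0 v\<close>.

  The second factor commutes with the points of the axis and so fixes them; on a vector \<open>y\<close> based at
  such a point it acts as \<open>cos t + sin t \<epsilon> v\<close>, which is the quaternion form of Rodrigues'
  formula for the angle \<open>2 t\<close> (lemma \<open>rotation_moves\<close>). The first factor adds \<open>2 u v\<close> to every point (lemma
  \<open>translation_moves\<close>).

  It remains to pass from points to planes and lines. A point lies on a plane if and only if their
  representatives commute, and the outer product of two vectors is half their commutator. Conjugation by
  an invertible element that preserves vectors respects both relations (lemma \<open>represents_motionI\<close>).
\<close>

section \<open>Vectors of euclidean space inside the algebra\<close>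

definition evec :: "real^3 \<Rightarrow> pga" where
  "evec x = (x$1) *\<^sub>R e 1 + (x$2) *\<^sub>R e 2 + (x$3) *\<^sub>R e 3"

definition evol :: pga where
  "evol = e 1 * e 2 * e 3"

lemma index_cases: "i = 0 \<or> i = 1 \<or> i = 2 \<or> i = 3" for i :: 4
proof -
  obtain z :: int where "i = of_int z" "0 \<le> z" "z < 4"
    by (cases i) auto
  moreover from this have "z = 0 \<or> z = 1 \<or> z = 2 \<or> z = 3"
    by presburger
  ultimately show ?thesis
    by auto
qed

lemma descending_indices [simp]:
  "\<not> (1::4) < 0" "\<not> (2::4) < 0" "\<not> (3::4) < 0" "\<not> (2::4) < 1" "\<not> (3::4) < 1" "\<not> (3::4) < 2"
  by (simp_all add: not_less less_imp_le)

lemma e_squares: "e 0 * e 0 = 0" "e 1 * e 1 = 1" "e 2 * e 2 = 1" "e 3 * e 3 = 1"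
  by (simp_all add: e_square gen_square_def)

lemma e_sort:
  "e 1 * e 0 = - (e 0 * e 1)" "e 2 * e 0 = - (e 0 * e 2)" "e 3 * e 0 = - (e 0 * e 3)"
  "e 2 * e 1 = - (e 1 * e 2)" "e 3 * e 1 = - (e 1 * e 3)" "e 3 * e 2 = - (e 2 * e 3)"
  by (rule e_anticommute; simp)+

text \<open>
  Turns a rewrite rule for a product of two factors into one that also fires inside a longer product
  bracketed to the right.
\<close>

lemma mult_extend:
  fixes a b c :: pga
  shows "a * b = c \<Longrightarrow> a * (b * z) = c * z"
  by (simp add: mult.assoc[symmetric])

lemmas e_normal = e_squares e_sort e_squares[THEN mult_extend] e_sort[THEN mult_extend]

lemma evol_square: "evol * evol = -1"
  by (simp add: evol_def mult.assoc e_normal)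

lemma evol_e0: "evol * e 0 = - (e 0 * evol)"
  by (simp add: evol_def mult.assoc e_normal)

lemma evec_e0: "evec x * e 0 = - (e 0 * evec x)"
  by (simp add: evec_def ring_distribs e_normal)

lemma evec_evol: "evec x * evol = evol * evec x"
  by (simp add: evec_def evol_def ring_distribs mult.assoc e_normal)

text \<open>
  Words in \<open>e 0\<close>, \<open>evol\<close> and vectors are sorted in this order by these rules; \<open>evec_mult\<close> below
  then reduces products of vectors.
\<close>

lemmas normal_order = evol_square evol_e0 evec_e0 evec_evol e_squares(1)
  evol_square[THEN mult_extend] evol_e0[THEN mult_extend] evec_e0[THEN mult_extend]
  evec_evol[THEN mult_extend] e_squares(1)[THEN mult_extend]

lemma evec_mult: "evec x * evec y = of_real (x \<bullet> y) + evol * evec (x \<times> y)"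
  by (simp add: evec_def evol_def ring_distribs mult.assoc e_normal cross3_simps of_real_def
      scaleR_left_distrib scaleR_diff_left)

lemma evec_linear: "evec (x + y) = evec x + evec y" "evec (x - y) = evec x - evec y"
  "evec (- x) = - evec x" "evec (r *\<^sub>R x) = r *\<^sub>R evec x" "evec 0 = 0"
  by (simp_all add: evec_def algebra_simps)

lemma evec_commutator: "evec v * evec y - evec y * evec v = 2 *\<^sub>R (evol * evec (v \<times> y))"
  by (simp add: evec_mult inner_commute[of y v] cross_skew[of y v] evec_linear scaleR_2)

lemma pseudoscalar_eq: "pseudoscalar = e 0 * evol"
  by (simp add: pseudoscalar_def evol_def mult.assoc)

lemma point_eq: "point p = evol - e 0 * evol * evec p"
  by (simp add: point_def evec_def evol_def ring_distribs mult.assoc e_normal)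

section \<open>Coefficients\<close>

text \<open>
  Together with \<open>pga_eq_iff\<close> these rules reduce an identity between linear combinations of
  multivectors to one between real numbers, where \<open>algebra_simps\<close> decides.
\<close>

lemma coeff_linear:
  "coeff (x + y) A = coeff x A + coeff y A" "coeff (x - y) A = coeff x A - coeff y A"
  "coeff (- x) A = - coeff x A" "coeff (r *\<^sub>R x) A = r * coeff x A" "coeff 0 A = 0"
  by (simp_all add: plus_pga.rep_eq minus_pga.rep_eq uminus_pga.rep_eq scaleR_pga.rep_eq
      zero_pga.rep_eq)

lemma pseudoscalar_blade: "pseudoscalar = blade {0, 1, 2, 3}"
  by (simp add: pseudoscalar_def blade_mult reorder_def insert_Diff_if insert_commute)

lemma point_blade:
  "point x = blade {1, 2, 3} - (x$1) *\<^sub>R blade {0, 2, 3} + (x$2) *\<^sub>R blade {0, 1, 3}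
     - (x$3) *\<^sub>R blade {0, 1, 2}"
  by (simp add: point_def mult.assoc e_normal)
    (simp add: blade_mult reorder_def insert_Diff_if insert_commute)

lemma evol_evec_blade:
  "evol * evec v = (v$1) *\<^sub>R blade {2, 3} - (v$2) *\<^sub>R blade {1, 3} + (v$3) *\<^sub>R blade {1, 2}"
  by (simp add: evol_def evec_def ring_distribs mult.assoc e_normal)
    (simp add: blade_mult reorder_def insert_Diff_if insert_commute)

lemma e0_evec_blade:
  "e 0 * evec v = (v$1) *\<^sub>R blade {0, 1} + (v$2) *\<^sub>R blade {0, 2} + (v$3) *\<^sub>R blade {0, 3}"
  by (simp add: evec_def ring_distribs)
    (simp add: blade_mult reorder_def insert_Diff_if insert_commute)

lemma vector1_eq: "vector1 a \<longleftrightarrow> (\<exists>r n. a = r *\<^sub>R e 0 + evec n)" (is "?l \<longleftrightarrow> ?r")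
proof
  assume ?l
  let ?b = "coeff a {0} *\<^sub>R e 0 + evec (vector [coeff a {1}, coeff a {2}, coeff a {3}])"
  have "coeff a A = coeff ?b A" for A
  proof (cases "card A = 1")
    case True
    then obtain i where "A = {i}"
      by (auto simp: card_1_singleton_iff)
    then show ?thesis
      using index_cases[of i] by (auto simp: evec_def coeff_linear blade.rep_eq)
  next
    case False
    then have "A \<noteq> {i}" for i
      by auto
    then show ?thesis
      using False \<open>?l\<close> by (auto simp: evec_def coeff_linear blade.rep_eq has_grade_def)
  qed
  then have "a = ?b"
    unfolding pga_eq_iff by blast
  then show ?r
    by blast
next
  assume ?r
  then show ?l
    by (auto simp: has_grade_def coeff_linear evec_def blade.rep_eq)
qed

lemma vector1E:
  assumes "vector1 a"
  obtains r n where "a = r *\<^sub>R e 0 + evec n"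
  using assms vector1_eq by blast

lemma plane_points_evec: "p \<in> plane_points (r *\<^sub>R e 0 + evec n) \<longleftrightarrow> r + n \<bullet> p = 0"
  by (simp add: plane_points_def evec_def coeff_linear blade.rep_eq inner_vec_def sum_3 add.assoc)

lemma point_inject: "point x = point y \<longleftrightarrow> x = y"
proof
  assume eq: "point x = point y"
  have "x $ 1 = y $ 1" "x $ 2 = y $ 2" "x $ 3 = y $ 3"
    using arg_cong[OF eq, of "\<lambda>z. coeff z {0, 2, 3}"] arg_cong[OF eq, of "\<lambda>z. coeff z {0, 1, 3}"]
      arg_cong[OF eq, of "\<lambda>z. coeff z {0, 1, 2}"]
    by (simp_all add: point_blade coeff_linear blade.rep_eq insert_eq_iff)
  then show "x = y"
    by (simp add: vec_eq_iff forall_3)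
qed simp

text \<open>
  Both sides are bilinear, so it suffices to compare them on generators: for \<open>i \<noteq> j\<close> the metric does
  not enter and \<open>e i\<close>, \<open>e j\<close> anticommute, for \<open>i = j\<close> both sides vanish.
\<close>

lemma outer_vectors:
  assumes "vector1 a" "vector1 b"
  shows "outer a b = (1/2) *\<^sub>R (a * b - b * a)"
proof -
  have bilinear: "outer (x + y) z = outer x z + outer y z" "outer x (y + z) = outer x y + outer x z"
    "outer (r *\<^sub>R x) y = r *\<^sub>R outer x y" "outer x (r *\<^sub>R y) = r *\<^sub>R outer x y" for x y z r
    by (simp_all add: pga_eq_iff outer.rep_eq plus_pga.rep_eq scaleR_pga.rep_eq blade_prod_alt
        algebra_simps sum.distrib sum_distrib_left)
  have outer_blade: "outer (blade A) (blade B) = reorder (\<lambda>i. 0) A B *\<^sub>R blade (sym_diff A B)" for A B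
  proof -
    have "(\<Sum>A'\<in>UNIV. reorder (\<lambda>i. 0) A' (sym_diff A' C) * (if A' = A then 1 else 0)
             * (if sym_diff A' C = B then 1 else 0))
        = (\<Sum>A'\<in>UNIV. if A' = A then reorder (\<lambda>i. 0) A (sym_diff A C)
             * (if sym_diff A C = B then 1 else 0) else 0)" for C
      by (rule sum.cong) auto
    moreover have "sym_diff A C = B \<longleftrightarrow> C = sym_diff A B" for C
      by auto
    ultimately show ?thesis
      by (auto simp: pga_eq_iff outer.rep_eq scaleR_pga.rep_eq blade.rep_eq blade_prod_alt
          sym_diff_cancel)
  qed
  have "outer (e i) (e j) = (if i = j then 0 else e i * e j)" for i j
    by (simp add: outer_blade blade_mult reorder_def)
  moreover obtain r n s k where "a = r *\<^sub>R e 0 + evec n" "b = s *\<^sub>R e 0 + evec k"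
    using assms by (metis vector1E)
  ultimately show ?thesis
    by (simp add: evec_def bilinear ring_distribs e_normal scaleR_right_distrib
        scaleR_right_diff_distrib)
      (simp add: pga_eq_iff coeff_linear field_simps)
qed

text \<open>Reversal changes the sign exactly in grades 2 and 3.\<close>

lemma reversal_even_parts:
  assumes "bivector \<Xi>"
  shows "reversal (of_real r + of_real s * pseudoscalar + \<Xi>)
    = of_real r + of_real s * pseudoscalar - \<Xi>"
proof -
  have 1: "coeff \<Xi> A * (-1) ^ (card A choose 2) = - coeff \<Xi> A" for A
    using assms by (cases "card A = 2") (auto simp: has_grade_def)
  have 2: "of_real r + of_real s * pseudoscalar = r *\<^sub>R blade {} + s *\<^sub>R blade {0, 1, 2, 3}"
    by (simp add: of_real_def blade_empty pseudoscalar_blade)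
  show ?thesis
    unfolding 2 using 1
    by (auto simp: pga_eq_iff reversal.rep_eq coeff_linear blade.rep_eq algebra_simps eval_nat_numeral)
qed

section \<open>Dual numbers\<close>

lemma dual_number_eq_iff:
  "of_real a + of_real b * pseudoscalar = of_real c + of_real d * pseudoscalar \<longleftrightarrow> a = c \<and> b = d"
proof
  assume eq: "of_real a + of_real b * pseudoscalar = of_real c + of_real d * pseudoscalar"
  show "a = c \<and> b = d"
    using arg_cong[OF eq, of "\<lambda>x. coeff x {}"] arg_cong[OF eq, of "\<lambda>x. coeff x {0, 1, 2, 3}"]
    by (simp add: pseudoscalar_blade of_real_def coeff_linear one_pga.rep_eq blade.rep_eq)
qed simp

lemma pseudoscalar_square: "pseudoscalar * pseudoscalar = 0"
  by (simp add: pseudoscalar_eq mult.assoc normal_order)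

lemma dual_number_mult:
  "(of_real a + of_real b * pseudoscalar) * (of_real c + of_real d * pseudoscalar)
    = of_real (a * c) + of_real (a * d + b * c) * pseudoscalar"
  by (simp add: of_real_def ring_distribs pseudoscalar_square algebra_simps)

section \<open>From points to planes and lines\<close>

text \<open>
  The commutator of a vector and a point is twice their outer product, which is the value of the plane
  equation at the point times \<open>I\<close>.
\<close>

lemma incidence_iff_commute:
  assumes "vector1 a"
  shows "p \<in> plane_points a \<longleftrightarrow> a * point p = point p * a"
proof -
  obtain r n where a: "a = r *\<^sub>R e 0 + evec n"
    using assms by (rule vector1E)
  have "a * point p - point p * a = (2 * (r + n \<bullet> p)) *\<^sub>R pseudoscalar"
    by (simp add: a point_eq pseudoscalar_eq ring_distribs mult.assoc normal_order evec_mult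
        inner_commute[of p n] cross_skew[of p n] evec_linear)
      (simp add: pga_eq_iff coeff_linear of_real_def algebra_simps)
  moreover have "pseudoscalar \<noteq> 0"
    using dual_number_eq_iff[of 0 1 0 0] by simp
  moreover have "p \<in> plane_points a \<longleftrightarrow> r + n \<bullet> p = 0"
    by (simp add: a plane_points_evec)
  ultimately show ?thesis
    by (metis (no_types) diff_self eq_iff_diff_eq_0 mult_eq_0_iff scaleR_eq_0_iff zero_neq_numeral)
qed

text \<open>
  The inverse \<open>h\<close> of \<open>g\<close> is a separate argument, so that composition and inversion can be
  treated without knowing how reversal acts on products.
\<close>

definition conjugation_moves :: "pga \<Rightarrow> pga \<Rightarrow> (real^3 \<Rightarrow> real^3) \<Rightarrow> bool" where
  "conjugation_moves g h f \<longleftrightarrow> g * h = 1 \<and> h * g = 1 \<and> (\<forall>x. g * point x * h = point (f x)) \<and>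
    (\<forall>a. vector1 a \<longrightarrow> vector1 (g * a * h))"

lemma conjugation_moves_comp:
  assumes "conjugation_moves g h f" "conjugation_moves k l f'"
  shows "conjugation_moves (g * k) (l * h) (f \<circ> f')"
proof -
  have c: "g * k * x * (l * h) = g * (k * x * l) * h" for x
    by (simp only: mult.assoc)
  have "g * k * (l * h) = 1"
    using c[of 1] assms by (simp add: conjugation_moves_def)
  moreover have "l * h * (g * k) = l * (h * g) * k"
    by (simp only: mult.assoc)
  ultimately show ?thesis
    using assms by (simp add: conjugation_moves_def c)
qed

lemma conjugation_mult:
  assumes "h * g = (1::pga)"
  shows "(g * x * h) * (g * y * h) = g * (x * y) * h"
proof -
  have "(g * x * h) * (g * y * h) = g * x * (h * g) * y * h"
    by (simp only: mult.assoc)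
  then show ?thesis
    by (simp add: assms mult.assoc)
qed

lemma conjugation_plane_points:
  assumes "conjugation_moves g h f" "vector1 a" "p \<in> plane_points a"
  shows "f p \<in> plane_points (g * a * h)"
proof -
  have hg: "h * g = 1" and v: "vector1 (g * a * h)" and p: "point (f p) = g * point p * h"
    using assms by (simp_all add: conjugation_moves_def)
  show ?thesis
    using assms(2,3) by (simp add: incidence_iff_commute v p conjugation_mult[OF hg] del: One_nat_def)
qed

lemma conjugation_outer:
  assumes "conjugation_moves g h f" "vector1 a" "vector1 b"
  shows "g * outer a b * h = outer (g * a * h) (g * b * h)"
proof -
  have hg: "h * g = 1" and v: "vector1 (g * a * h)" "vector1 (g * b * h)"
    using assms by (simp_all add: conjugation_moves_def)
  show ?thesis
    by (simp add: outer_vectors[OF assms(2,3)] outer_vectors[OF v] conjugation_mult[OF hg])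
      (simp add: algebra_simps)
qed

lemma conjugation_line_points:
  assumes "conjugation_moves g h f" "p \<in> line_points \<Lambda>"
  shows "f p \<in> line_points (g * \<Lambda> * h)"
proof -
  obtain a b where ab: "vector1 a" "vector1 b" "\<Lambda> = outer a b" "p \<in> plane_points a" "p \<in> plane_points b"
    using assms(2) unfolding line_points_def by blast
  have "vector1 (g * a * h)" "vector1 (g * b * h)"
    using assms(1) ab by (simp_all add: conjugation_moves_def)
  moreover have "g * \<Lambda> * h = outer (g * a * h) (g * b * h)"
    unfolding ab(3) by (rule conjugation_outer[OF assms(1) ab(1,2)])
  moreover have "f p \<in> plane_points (g * a * h)" "f p \<in> plane_points (g * b * h)"
    using conjugation_plane_points[OF assms(1)] ab by blast+
  ultimately show ?thesis
    unfolding line_points_def by blast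
qed

lemma conjugation_inverse:
  assumes "conjugation_moves g h f" "conjugation_moves h g f'"
  shows "f (f' x) = x" "h * (g * z * h) * g = z"
proof -
  have gh: "g * h = 1" "h * g = 1"
    using assms by (simp_all add: conjugation_moves_def)
  have cancel: "k * (l * z * k) * l = z" if "k * l = 1" for k l z :: pga
  proof -
    have "k * (l * z * k) * l = (k * l) * z * (k * l)"
      by (simp only: mult.assoc)
    then show ?thesis
      by (simp add: that)
  qed
  show "h * (g * z * h) * g = z"
    by (rule cancel[OF gh(2)])
  have "point (f (f' x)) = g * (h * point x * g) * h"
    using assms by (simp add: conjugation_moves_def)
  then show "f (f' x) = x"
    by (simp add: cancel[OF gh(1)] point_inject)
qed

text \<open>
  Incidence is preserved by conjugation with \<open>g\<close>, which gives one inclusion for the images of planes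
  and lines; the inverse conjugation gives the other.
\<close>

lemma represents_motionI:
  assumes "conjugation_moves g h f" "conjugation_moves h g f'" "reversal g = h"
  shows "represents_motion g f"
  unfolding represents_motion_def assms(3)
proof (intro conjI allI impI)
  note inv = conjugation_inverse[OF assms(1,2)]
  have image: "T = f ` S"
    if "\<And>p. p \<in> S \<Longrightarrow> f p \<in> T" "\<And>q. q \<in> T \<Longrightarrow> f' q \<in> S" for S T
  proof
    show "T \<subseteq> f ` S"
    proof
      fix q assume "q \<in> T"
      then have "f (f' q) \<in> f ` S"
        using that(2) by blast
      then show "q \<in> f ` S"
        by (simp only: inv(1))
    qed
  qed (use that(1) in blast)
  show "g * point p * h = point (f p)" for p
    using assms(1) by (simp add: conjugation_moves_def)
  show v: "vector1 (g * a * h)" if "vector1 a" for a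
    using assms(1) that by (simp add: conjugation_moves_def)
  show "plane_points (g * a * h) = f ` plane_points a" if "vector1 a" for a
    using conjugation_plane_points[OF assms(1) that] conjugation_plane_points[OF assms(2) v[OF that]]
    by (intro image) (simp_all only: inv(2))
  show "simple_bivector (g * \<Lambda> * h)" if "simple_bivector \<Lambda>" for \<Lambda>
    using that conjugation_outer[OF assms(1)] v unfolding simple_bivector_def by blast
  show "line_points (g * \<Lambda> * h) = f ` line_points \<Lambda>" for \<Lambda>
    using conjugation_line_points[OF assms(1), of _ \<Lambda>]
      conjugation_line_points[OF assms(2), of _ "g * \<Lambda> * h"]
    by (intro image) (simp_all only: inv(2))
qed

text \<open>
  If \<open>B\<^sup>2 = l\<close> is a scalar, the quadratic term \<open>B a B\<close> of the conjugation can be recovered from the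
  iterated commutator \<open>[B, [B, a]] = 2 l a - 2 B a B\<close>. So preserving vectors is a matter of
  commutators only, and the commutator of a bivector with a vector is a vector.
\<close>

lemma sandwich_vector1:
  assumes B: "B * B = of_real l" and "\<And>a. vector1 a \<Longrightarrow> vector1 (B * a - a * B)" and "vector1 a"
  shows "vector1 ((of_real r + s *\<^sub>R B) * a * (of_real r - s *\<^sub>R B))"
proof -
  let ?c = "\<lambda>a. B * a - a * B"
  have double: "?c (?c a) = (2 * l) *\<^sub>R a - 2 *\<^sub>R (B * a * B)"
  proof -
    have "B * (B * a) = l *\<^sub>R a" "a * (B * B) = l *\<^sub>R a"
      using B by (simp_all add: of_real_def flip: mult.assoc)
    then show ?thesis
      by (simp add: ring_distribs mult.assoc) (simp add: pga_eq_iff coeff_linear algebra_simps)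
  qed
  have "(of_real r + s *\<^sub>R B) * a * (of_real r - s *\<^sub>R B)
    = (r^2 - s^2 * l) *\<^sub>R a + (r * s) *\<^sub>R ?c a + (s^2/2) *\<^sub>R ?c (?c a)"
    unfolding double by (simp add: of_real_def algebra_simps power2_eq_square)
  moreover have "vector1 (x *\<^sub>R a + y *\<^sub>R b + z *\<^sub>R c)" if "vector1 a" "vector1 b" "vector1 c"
    for x y z a b c
    using that by (simp add: has_grade_def coeff_linear)
  ultimately show ?thesis
    using assms by simp
qed

lemma commutator_vector1:
  assumes "vector1 a"
  shows "vector1 ((evol * evec v + e 0 * evec m) * a - a * (evol * evec v + e 0 * evec m))"
proof -
  obtain r n where a: "a = r *\<^sub>R e 0 + evec n"
    using assms by (rule vector1E)
  have "(evol * evec v + e 0 * evec m) * a - a * (evol * evec v + e 0 * evec m)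
    = (2 * (m \<bullet> n)) *\<^sub>R e 0 + evec (- 2 *\<^sub>R (v \<times> n))"
    by (simp add: a ring_distribs mult.assoc normal_order evec_mult
        inner_commute[of n] cross_skew[of n] evec_linear)
      (simp add: pga_eq_iff coeff_linear of_real_def algebra_simps)
  then show ?thesis
    unfolding vector1_eq by blast
qed

section \<open>Lines, rotations and translations\<close>

definition line_through :: "real^3 \<Rightarrow> real^3 \<Rightarrow> pga" where
  "line_through p v = evol * evec v + e 0 * evec (p \<times> v)"

lemma line_through_square:
  assumes "norm v = 1"
  shows "line_through p v * line_through p v = -1"
proof -
  have "v \<bullet> v = 1"
    using assms by (simp add: norm_eq_1)
  then show ?thesis
    by (simp add: line_through_def ring_distribs mult.assoc normal_order evec_mult dot_cross_self
        inner_commute[of v "p \<times> v"] cross_skew[of v "p \<times> v"] evec_linear)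
qed

lemma line_through_point: "line_through p v * point p = point p * line_through p v"
  by (simp add: line_through_def point_eq ring_distribs mult.assoc normal_order evec_mult
      dot_cross_self inner_commute[of v p] cross_skew[of v p] evec_linear)

lemma line_through_pseudoscalar:
  "pseudoscalar * line_through p v = line_through p v * pseudoscalar"
  by (simp add: pseudoscalar_eq line_through_def ring_distribs mult.assoc normal_order)

lemma line_direction_line_through:
  assumes "norm v = 1"
  shows "line_direction (line_through p v) = v"
proof -
  have "vector [coeff (line_through p v) {2, 3}, - coeff (line_through p v) {1, 3},
      coeff (line_through p v) {1, 2}] = v"
    by (simp add: line_through_def evol_evec_blade e0_evec_blade coeff_linear blade.rep_eq vec_eq_iff
        forall_3 insert_eq_iff)
  then show ?thesis
    using assms by (simp add: line_direction_def sgn_div_norm)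
qed

text \<open>
  The intersection of the planes \<open>r + n \<bullet> x = 0\<close> and \<open>s + k \<bullet> x = 0\<close> has direction \<open>v = n \<times> k\<close> and
  moment \<open>m = r k - s n\<close>, in terms of which \<open>\<Phi> = \<epsilon> v + e\<^sub>0 m\<close>. The scalar part of \<open>\<Phi>\<^sup>2 = -1\<close> makes
  \<open>v\<close> a unit vector; the foot of the perpendicular from the origin, \<open>v \<times> m\<close>, then lies on both planes.
\<close>

lemma line_through_of_simple:
  assumes "simple_bivector \<Phi>" "\<Phi> * \<Phi> = -1"
  obtains p v where "norm v = 1" "\<Phi> = line_through p v" "p \<in> line_points \<Phi>"
proof -
  obtain a b where ab: "vector1 a" "vector1 b" "\<Phi> = outer a b"
    using assms by (auto simp: simple_bivector_def)
  obtain r n s k where a: "a = r *\<^sub>R e 0 + evec n" and b: "b = s *\<^sub>R e 0 + evec k"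
    using ab by (metis vector1E)
  define v where "v = n \<times> k"
  define m where "m = r *\<^sub>R k - s *\<^sub>R n"
  define p where "p = v \<times> m"
  have \<Phi>: "\<Phi> = evol * evec v + e 0 * evec m"
    unfolding ab(3) outer_vectors[OF ab(1,2)]
    by (simp add: a b ring_distribs mult.assoc normal_order evec_mult v_def m_def
        inner_commute[of k n] cross_skew[of k n] evec_linear)
      (simp add: pga_eq_iff coeff_linear algebra_simps)
  have vm: "v \<bullet> m = 0"
    by (simp add: v_def m_def inner_diff_right dot_cross_self)
  have "\<Phi> * \<Phi> = of_real (- (v \<bullet> v)) + of_real (2 * (v \<bullet> m)) * pseudoscalar"
    by (simp add: \<Phi> ring_distribs mult.assoc normal_order evec_mult pseudoscalar_eq
        inner_commute[of m v] cross_skew[of m v] evec_linear of_real_def)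
      (simp add: pga_eq_iff coeff_linear algebra_simps)
  also have "\<dots> = of_real (-1) + of_real 0 * pseudoscalar \<longleftrightarrow> v \<bullet> v = 1"
    unfolding dual_number_eq_iff by (auto simp: vm)
  finally have vv: "v \<bullet> v = 1"
    using assms(2) by simp
  have "p \<times> v = - (v \<times> (v \<times> m))"
    by (simp add: p_def cross_skew[of _ v])
  also have "\<dots> = m"
    by (simp add: Lagrange vm vv)
  finally have line: "\<Phi> = line_through p v"
    by (simp add: \<Phi> line_through_def)
  have n: "n \<bullet> p = - r"
  proof -
    have "n \<bullet> p = - (v \<bullet> (n \<times> m))"
      unfolding p_def by (simp add: cross3_simps)
    also have "n \<times> m = r *\<^sub>R v"
      by (simp add: m_def v_def cross3_simps)
    finally show ?thesis
      by (simp add: vv)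
  qed
  have k: "k \<bullet> p = - s"
  proof -
    have "k \<bullet> p = - (v \<bullet> (k \<times> m))"
      unfolding p_def by (simp add: cross3_simps)
    also have "k \<times> m = s *\<^sub>R v"
      by (simp add: m_def v_def cross3_simps)
    finally show ?thesis
      by (simp add: vv)
  qed
  have "p \<in> plane_points a" "p \<in> plane_points b"
    by (simp_all add: a b plane_points_evec n k)
  then have "p \<in> line_points \<Phi>"
    using ab unfolding line_points_def by blast
  then show ?thesis
    using that[of v p] line vv by (simp add: norm_eq_1)
qed

lemma translation_moves:
  "conjugation_moves (1 - u *\<^sub>R (e 0 * evec v)) (1 + u *\<^sub>R (e 0 * evec v)) (\<lambda>x. x + (2 * u) *\<^sub>R v)"
  unfolding conjugation_moves_def
proof (intro conjI allI impI)
  let ?T = "1 - u *\<^sub>R (e 0 * evec v)" and ?T' = "1 + u *\<^sub>R (e 0 * evec v)"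
  show "?T * ?T' = 1" "?T' * ?T = 1"
    by (simp_all add: ring_distribs mult.assoc normal_order)
  show "?T * point x * ?T' = point (x + (2 * u) *\<^sub>R v)" for x
    by (simp add: point_eq ring_distribs mult.assoc normal_order evec_linear scaleR_2)
      (simp add: pga_eq_iff coeff_linear algebra_simps)
  \<comment> \<open>\<open>e 0 * evec v\<close> is the bivector with direction \<open>0\<close> and moment \<open>v\<close>, and its square is \<open>0\<close>.\<close>
  show "vector1 (?T * a * ?T')" if "vector1 a" for a
    using sandwich_vector1[OF _ commutator_vector1[of _ 0 v] that, of 0 1 "-u"]
    by (simp add: evec_linear mult.assoc normal_order)
qed

text \<open>
  Conjugation by a unit vector is minus the reflection in the plane orthogonal to it: swap the two
  factors \<open>evec y * evec v\<close> at the cost of the scalar \<open>2 (v \<bullet> y)\<close>.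
\<close>

lemma evec_sandwich:
  assumes "norm v = 1"
  shows "evec v * (evec y * evec v) = evec ((2 * (v \<bullet> y)) *\<^sub>R v - y)"
proof -
  have "v \<bullet> v = 1"
    using assms by (simp add: norm_eq_1)
  then have 1: "evec v * evec v = 1"
    by (simp add: evec_mult evec_linear)
  have "evec y * evec v = (2 * (v \<bullet> y)) *\<^sub>R 1 - evec v * evec y"
    by (simp add: evec_mult inner_commute[of y v] cross_skew[of y v] evec_linear of_real_def)
      (simp add: pga_eq_iff coeff_linear)
  then have "evec v * (evec y * evec v) = (2 * (v \<bullet> y)) *\<^sub>R evec v - evec v * evec v * evec y"
    by (simp add: ring_distribs mult.assoc)
  then show ?thesis
    unfolding 1 by (simp add: evec_linear)
qed

text \<open>
  Write \<open>x = p + y\<close>. The axis commutes with its point \<open>p\<close>, so \<open>p\<close> is fixed, and the remaining term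
  \<open>- e\<^sub>0 \<epsilon> y\<close> of the point \<open>x\<close> kills the moment of the axis because \<open>e\<^sub>0\<^sup>2 = 0\<close>. What is left is the
  conjugation of \<open>y\<close> by the quaternion \<open>cos t + sin t \<epsilon> v\<close>. Its mixed term
  \<open>\<epsilon> (v y - y v) = - 2 v \<times> y\<close> shows that the rotation is right-handed about \<open>- v\<close>.
\<close>

lemma rotation_moves:
  assumes "norm v = 1"
  shows "conjugation_moves (of_real (cos t) + sin t *\<^sub>R line_through p v)
    (of_real (cos t) - sin t *\<^sub>R line_through p v) (rotation_about p (- v) (2 * t))"
  unfolding conjugation_moves_def
proof (intro conjI allI impI)
  let ?L = "line_through p v"
  let ?R = "of_real (cos t) + sin t *\<^sub>R ?L" and ?R' = "of_real (cos t) - sin t *\<^sub>R ?L"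
  have cs: "cos t * cos t + sin t * sin t = 1"
    by (simp flip: power2_eq_square)
  have "(of_real c + s *\<^sub>R ?L) * (of_real c - s *\<^sub>R ?L) = (c * c + s * s) *\<^sub>R 1"
    "(of_real c - s *\<^sub>R ?L) * (of_real c + s *\<^sub>R ?L) = (c * c + s * s) *\<^sub>R 1" for c s
    by (simp_all add: of_real_def ring_distribs line_through_square[OF assms])
      (simp_all add: pga_eq_iff coeff_linear algebra_simps)
  then show RR: "?R * ?R' = 1" "?R' * ?R = 1"
    by (simp_all only: cs scaleR_one)
  show "vector1 (?R * a * ?R')" if "vector1 a" for a
    using sandwich_vector1[OF _ _ that, of ?L "-1"] commutator_vector1[of _ v "p \<times> v"]
    by (simp add: line_through_square[OF assms] flip: line_through_def)
  show "?R * point x * ?R' = point (rotation_about p (- v) (2 * t) x)" for x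
  proof -
    define y where "y = x - p"
    have shift: "point (p + z) = point p - e 0 * evol * evec z" for z
      by (simp add: point_eq evec_linear ring_distribs)
    have "?R * point p = point p * ?R"
      using line_through_point[of p v] by (simp add: of_real_def ring_distribs)
    then have fixed: "?R * point p * ?R' = point p"
      by (simp add: mult.assoc RR)
    have "?R * (e 0 * evol * evec y) * ?R' = e 0 * evol * ((cos t * cos t) *\<^sub>R evec y
       + (cos t * sin t) *\<^sub>R (evol * (evec v * evec y - evec y * evec v))
       + (sin t * sin t) *\<^sub>R (evec v * (evec y * evec v)))"
      by (simp add: of_real_def line_through_def ring_distribs mult.assoc normal_order)
        (simp add: algebra_simps)
    also have "\<dots> = e 0 * evol * evec ((cos t * cos t - sin t * sin t) *\<^sub>R y
       - (2 * sin t * cos t) *\<^sub>R (v \<times> y) + (2 * (sin t * sin t) * (v \<bullet> y)) *\<^sub>R v)"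
      unfolding evec_sandwich[OF assms] evec_commutator
      by (simp add: evec_linear ring_distribs mult.assoc normal_order)
        (simp add: pga_eq_iff coeff_linear algebra_simps)
    also have "(cos t * cos t - sin t * sin t) *\<^sub>R y - (2 * sin t * cos t) *\<^sub>R (v \<times> y)
       + (2 * (sin t * sin t) * (v \<bullet> y)) *\<^sub>R v = rotation_about p (- v) (2 * t) x - p"
    proof -
      have "sin t * sin t = 1 - cos t * cos t"
        using cs by linarith
      then show ?thesis
        by (simp add: rotation_about_def y_def cos_double sin_double power2_eq_square)
    qed
    finally have moved: "?R * (e 0 * evol * evec y) * ?R'
      = e 0 * evol * evec (rotation_about p (- v) (2 * t) x - p)" .
    have distrib: "a * (b - c) * d = a * b * d - a * c * d" for a b c d :: pga
      by (simp add: algebra_simps)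
    have "?R * point (p + y) * ?R' = point (p + (rotation_about p (- v) (2 * t) x - p))"
      unfolding shift distrib fixed moved ..
    then show ?thesis
      by (simp add: y_def)
  qed
qed

section \<open>Screw motions\<close>

definition screw_motor :: "real^3 \<Rightarrow> real^3 \<Rightarrow> real \<Rightarrow> real \<Rightarrow> pga" where
  "screw_motor p v t u
    = (1 - u *\<^sub>R (e 0 * evec v)) * (of_real (cos t) + sin t *\<^sub>R line_through p v)"

text \<open>
  The exponential of \<open>(t + u I) \<Phi>\<close> for the line \<open>\<Phi>\<close>: the coefficients are the dual cosine and sine of
  \<open>t + u I\<close>.
\<close>

lemma screw_motor_eq:
  assumes "norm v = 1"
  shows "screw_motor p v t u = of_real (cos t) + of_real (- u * sin t) * pseudoscalar
     + (of_real (sin t) + of_real (u * cos t) * pseudoscalar) * line_through p v"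
proof -
  have "pseudoscalar * line_through p v = - (e 0 * evec v)"
    by (simp add: pseudoscalar_eq line_through_def ring_distribs mult.assoc normal_order)
  then have "screw_motor p v t u = (1 + u *\<^sub>R (pseudoscalar * line_through p v))
      * (of_real (cos t) + sin t *\<^sub>R line_through p v)"
    by (simp add: screw_motor_def)
  then show ?thesis
    by (simp add: of_real_def ring_distribs mult.assoc line_through_square[OF assms]
        scaleR_right_distrib algebra_simps)
qed

text \<open>
  The factors commute because rotation and translation share their direction; therefore negating both
  parameters inverts the motor.
\<close>

lemma screw_moves:
  assumes "norm v = 1"
  shows "conjugation_moves (screw_motor p v t u) (screw_motor p v (- t) (- u))
     ((\<lambda>x. x + (2 * u) *\<^sub>R v) \<circ> rotation_about p (- v) (2 * t))"
proof -
  have "line_through p v * (e 0 * evec v) = (e 0 * evec v) * line_through p v"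
    by (simp add: line_through_def ring_distribs mult.assoc normal_order)
  then have "screw_motor p v (- t) (- u)
    = (of_real (cos t) - sin t *\<^sub>R line_through p v) * (1 + u *\<^sub>R (e 0 * evec v))"
    by (simp add: screw_motor_def ring_distribs of_real_def)
      (simp add: pga_eq_iff coeff_linear algebra_simps)
  then show ?thesis
    using conjugation_moves_comp[OF translation_moves[of u v] rotation_moves[OF assms, of t p]]
    by (simp add: screw_motor_def)
qed

theorem theorem4:
  fixes g \<Xi> \<Phi> :: pga and s_r s_d t u :: real
  assumes "g = of_real s_r + of_real s_d * pseudoscalar + \<Xi>"
    and "bivector \<Xi>"
    and "rotor g"
    and "s_d \<noteq> 0"
    and "is_log s_r s_d \<Xi> t u \<Phi>"
  shows "u \<noteq> 0 \<and> t \<noteq> 0 \<and>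
    (\<exists>f. represents_motion g f \<and> screw_motion \<Phi> (2 * t) (2 * u) f)"
proof -
  let ?\<sigma> = "of_real s_r + of_real s_d * pseudoscalar"
  obtain a b c d where ax: "is_axis \<Xi> a b \<Phi>"
    and inv: "(of_real a + of_real b * pseudoscalar) * (of_real c + of_real d * pseudoscalar) = 1"
    and t: "t = Arg (Complex s_r c)"
    and u: "u = (if \<bar>cos t\<bar> > \<bar>sin t\<bar> then d / cos t else - s_d / sin t)"
    using assms(5) unfolding is_log_def by blast
  have "simple_bivector \<Phi>" "\<Phi> * \<Phi> = -1" 
    and \<Phi>: "\<Phi> = (of_real a + of_real b * pseudoscalar) * \<Xi>"
    using ax unfolding is_axis_def by blast+
  then obtain p v where v: "norm v = 1" and line: "\<Phi> = line_through p v" and p: "p \<in> line_points \<Phi>"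
    using line_through_of_simple by blast
  let ?\<tau> = "of_real c + of_real d * pseudoscalar"
  have "?\<tau> * (of_real a + of_real b * pseudoscalar) = 1"
    using inv by (simp add: dual_number_mult mult.commute add.commute)
  then have \<Xi>: "\<Xi> = ?\<tau> * \<Phi>"
    by (simp add: \<Phi> flip: mult.assoc)
  have com: "\<Phi> * (of_real x + of_real y * pseudoscalar)
    = (of_real x + of_real y * pseudoscalar) * \<Phi>" for x y
    by (simp add: line of_real_def ring_distribs line_through_pseudoscalar)
  have rev: "reversal g = ?\<sigma> - \<Xi>"
    using reversal_even_parts[OF assms(2)] assms(1) by simp
  have "?\<sigma> * \<Xi> = \<Xi> * ?\<sigma>"
    unfolding \<Xi> mult.assoc com by (simp add: dual_number_mult mult.commute add.commute flip: mult.assoc)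
  then have "(?\<sigma> + \<Xi>) * (?\<sigma> - \<Xi>) = ?\<sigma> * ?\<sigma> - \<Xi> * \<Xi>"
    by (simp only: ring_distribs) simp
  moreover have "\<Xi> * \<Xi> = - (?\<tau> * ?\<tau>)"
  proof -
    have "\<Xi> * \<Xi> = ?\<tau> * (\<Phi> * ?\<tau>) * \<Phi>"
      unfolding \<Xi> by (simp only: mult.assoc)
    also have "\<dots> = ?\<tau> * ?\<tau> * (\<Phi> * \<Phi>)"
      unfolding com by (simp only: mult.assoc)
    finally show ?thesis
      using \<open>\<Phi> * \<Phi> = -1\<close> by simp
  qed
  moreover have "(?\<sigma> + \<Xi>) * (?\<sigma> - \<Xi>) = 1"
    using assms(3) by (simp add: rotor_def rev flip: assms(1))
  ultimately have "?\<sigma> * ?\<sigma> + ?\<tau> * ?\<tau> = of_real 1 + of_real 0 * pseudoscalar"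
    by simp
  moreover have "?\<sigma> * ?\<sigma> + ?\<tau> * ?\<tau> = of_real (s_r * s_r + c * c)
    + of_real (2 * (s_r * s_d + c * d)) * pseudoscalar"
    unfolding dual_number_mult by (simp add: of_real_def algebra_simps)
  ultimately have one: "s_r * s_r + c * c = 1" and orth: "s_r * s_d + c * d = 0"
    using dual_number_eq_iff[of "s_r * s_r + c * c" "2 * (s_r * s_d + c * d)" 1 0] by auto
  have "Complex s_r c = cis t"
    using rcis_cmod_Arg[of "Complex s_r c"] one
    by (simp add: t rcis_def complex_norm power2_eq_square)
  then have cs: "s_r = cos t" "c = sin t" by (simp_all add: complex_eq_iff)
  have s0: "sin t \<noteq> 0"
    using orth assms(4) sin_zero_abs_cos_one[of t] by (auto simp: cs)
  \<comment> \<open>Each branch of \<open>u\<close> gives one of the equations directly; the other one follows from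
    \<open>orth\<close>, cancelling the cosine or the sine that is nonzero in that branch.\<close>
  have "d = u * cos t \<and> s_d = - u * sin t"
  proof (cases "\<bar>cos t\<bar> > \<bar>sin t\<bar>")
    case True
    then have "cos t \<noteq> 0" by auto
    moreover from this True have "d = u * cos t" by (simp add: u)
    moreover have "cos t * s_d = cos t * (- u * sin t)"
      using orth \<open>d = u * cos t\<close> by (simp add: cs algebra_simps)
    ultimately show ?thesis by (simp only: mult_cancel_left) simp
  next
    case False
    then have "s_d = - u * sin t" using s0 by (simp add: u)
    moreover have "sin t * d = sin t * (u * cos t)"
      using orth \<open>s_d = - u * sin t\<close> by (simp add: cs algebra_simps)
    ultimately show ?thesis using s0 by (simp only: mult_cancel_left) simp
  qed
  then have ds: "d = u * cos t" "s_d = - u * sin t" by simp_all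
  have g: "g = screw_motor p v t u"
    unfolding screw_motor_eq[OF v] assms(1) \<Xi> line unfolding cs ds ..
  have "reversal g = screw_motor p v (- t) (- u)"
    unfolding screw_motor_eq[OF v] rev \<Xi> line unfolding cs ds by (simp add: algebra_simps)
  then have "represents_motion g ((\<lambda>x. x + (2 * u) *\<^sub>R v) \<circ> rotation_about p (- v) (2 * t))"
    using represents_motionI[OF screw_moves[OF v, of p t u]] screw_moves[OF v, of p "- t" "- u"] 
    by (simp add: g)
  moreover have "screw_motion \<Phi> (2 * t) (2 * u) ((\<lambda>x. x + (2 * u) *\<^sub>R v) \<circ> rotation_about p (- v) (2 * t))"
    unfolding screw_motion_def using p line_direction_line_through[OF v, of p] line by auto
  ultimately show ?thesis
    using s0 ds assms(4) by auto
qed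

end
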